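(* Let $H\colon\mathbb R^n\rightrightarrows\mathbb R^n$ be an outer semicontinuous set-valued map that is locally bounded at a point $x\in\mathbb R^n$. Then $$\limsup_{\substack{y\to x\\\alpha\downarrow0}}\operatorname{co}H(B(y,\alpha))\subset\operatorname{co}H(x).$$
   Context: $B(y,\alpha)$ is the closed Euclidean ball; $H(S):=\bigcup_{z\in S}H(z)$; $\operatorname{co}$ is the convex hull. The outer limit on the left is the set of all $v\in\mathbb R^n$ for which there are $y_k\to x$, positive $\alpha_k\to0$, and $u_k\in\operatorname{co}H(B(y_k,\alpha_k))$ with $u_k\to v$. $H$ is outer semicontinuous at $\bar x$ if whenever $x_k\to\bar x$, $v_k\in H(x_k)$, and $v_k\to v$, then $v\in H(\bar x)$; $H$ is outer semicontinuous if this holds at every $\bar x$. $H$ is locally bounded at $x$ if $H(V)$ is bounded for some neighborhood $V$ of $x$. *)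

theory Defs
  imports "HOL-Analysis.Analysis"
begin

text \<open>A set-valued map is a function into sets; values are allowed to be empty.\<close>

definition svm_image :: "('a \<Rightarrow> 'b set) \<Rightarrow> 'a set \<Rightarrow> 'b set" where
  "svm_image H S = (\<Union>z\<in>S. H z)"

definition outer_semicontinuous_at ::
    "('a::topological_space \<Rightarrow> 'b::topological_space set) \<Rightarrow> 'a \<Rightarrow> bool" where
  "outer_semicontinuous_at H xbar \<longleftrightarrow>
     (\<forall>(x :: nat \<Rightarrow> 'a) (v :: nat \<Rightarrow> 'b) l.
        x \<longlonglongrightarrow> xbar \<longrightarrow> (\<forall>k. v k \<in> H (x k)) \<longrightarrow> v \<longlonglongrightarrow> l \<longrightarrow> l \<in> H xbar)"

definition outer_semicontinuous ::
    "('a::topological_space \<Rightarrow> 'b::topological_space set) \<Rightarrow> bool" where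
  "outer_semicontinuous H \<longleftrightarrow> (\<forall>xbar. outer_semicontinuous_at H xbar)"

text \<open>Neighborhoods need not be open: \<open>V\<close> is one of \<open>x\<close> iff \<open>x \<in> interior V\<close>.\<close>

definition locally_bounded_at ::
    "('a::topological_space \<Rightarrow> 'b::metric_space set) \<Rightarrow> 'a \<Rightarrow> bool" where
  "locally_bounded_at H x \<longleftrightarrow> (\<exists>V. x \<in> interior V \<and> bounded (svm_image H V))"

text \<open>Outer limit of \<open>S y \<alpha>\<close> as \<open>y \<rightarrow> x\<close> and \<open>\<alpha>\<close> decreases to 0 through positive values;
  \<open>y = x\<close> is allowed along the sequences.\<close>

definition outer_limit ::
    "('a::topological_space \<Rightarrow> real \<Rightarrow> 'b::topological_space set) \<Rightarrow> 'a \<Rightarrow> 'b set" where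
  "outer_limit S x =
     {v. \<exists>(y :: nat \<Rightarrow> 'a) (\<alpha> :: nat \<Rightarrow> real) (u :: nat \<Rightarrow> 'b).
           y \<longlonglongrightarrow> x \<and> (\<forall>k. \<alpha> k > 0) \<and> \<alpha> \<longlonglongrightarrow> 0 \<and>
           (\<forall>k. u k \<in> S (y k) (\<alpha> k)) \<and> u \<longlonglongrightarrow> v}"

end

theory Submission
  imports Defs
begin

text \<open>Suppose a limit \<open>v\<close> lay outside \<open>co H(x)\<close>. Local boundedness and outer semicontinuity make
  \<open>H(x)\<close> compact, so a hyperplane strictly separates \<open>v\<close> from \<open>co H(x)\<close>. The same hypotheses force
  \<open>H(z)\<close> into the open half-space around \<open>H(x)\<close> for all \<open>z\<close> near \<open>x\<close>. As a half-space is convex, the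
  hulls \<open>co H(B(y, \<alpha>))\<close> eventually lie in it too, which keeps \<open>v\<close> in the closed half-space.\<close>

text \<open>Otherwise points tending to \<open>x\<close> carry values outside \<open>U\<close>.
  Boundedness gives these values a cluster point, which outer semicontinuity puts in
  \<open>H x\<close> and closedness of \<open>- U\<close> keeps out of \<open>U\<close>.\<close>

lemma eventually_subset_of_outer_semicontinuous_at:
  fixes H :: "'a::metric_space \<Rightarrow> 'b::heine_borel set"
  assumes osc: "outer_semicontinuous_at H x" and lb: "locally_bounded_at H x"
    and "open U" and "H x \<subseteq> U"
  shows "\<exists>d>0. \<forall>z\<in>ball x d. H z \<subseteq> U"
proof (rule ccontr)
  assume contra: "\<not> (\<exists>d>0. \<forall>z\<in>ball x d. H z \<subseteq> U)"
  obtain V where "x \<in> interior V" and bddV: "bounded (svm_image H V)"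
    using lb unfolding locally_bounded_at_def by blast
  then obtain r where "r > 0" and "ball x r \<subseteq> V"
    unfolding mem_interior by blast
  then have bdd: "bounded (svm_image H (ball x r))"
    using bounded_subset[OF bddV] unfolding svm_image_def by blast
  \<comment> \<open>The bound \<open>r\<close> keeps the values in a bounded set; the bound
    \<open>inverse (real (Suc k))\<close> forces the points to converge to \<open>x\<close>.\<close>
  have "\<exists>z w. dist x z < min r (inverse (real (Suc k))) \<and> w \<in> H z \<and> w \<notin> U" for k
  proof -
    have "min r (inverse (real (Suc k))) > 0"
      using \<open>r > 0\<close> by simp
    then show ?thesis
      using contra by (meson mem_ball subsetI)
  qed
  then obtain z w where zw: "\<And>k. dist x (z k) < min r (inverse (real (Suc k)))"
      "\<And>k. w k \<in> H (z k)" "\<And>k. w k \<notin> U"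
    by metis
  have "(\<lambda>k. dist (z k) x) \<longlonglongrightarrow> 0"
    by (rule tendsto_sandwich[OF _ _ tendsto_const LIMSEQ_inverse_real_of_nat])
       (use zw(1) in \<open>auto simp: dist_commute less_imp_le\<close>)
  then have "z \<longlonglongrightarrow> x"
    by (rule tendsto_dist_iff[THEN iffD2])
  have "range w \<subseteq> svm_image H (ball x r)"
    using zw(1,2) unfolding svm_image_def by fastforce
  then obtain l s where s: "strict_mono s" and l: "(w \<circ> s) \<longlonglongrightarrow> l"
    using bounded_imp_convergent_subsequence[OF bounded_subset[OF bdd]] by blast
  have "(z \<circ> s) \<longlonglongrightarrow> x"
    using \<open>z \<longlonglongrightarrow> x\<close> s by (rule LIMSEQ_subseq_LIMSEQ)
  moreover have "\<forall>k. (w \<circ> s) k \<in> H ((z \<circ> s) k)"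
    using zw(2) by simp
  ultimately have "l \<in> H x"
    using osc l unfolding outer_semicontinuous_at_def by blast
  moreover have "l \<in> - U"
    using closed_sequentially[of "- U" "w \<circ> s" l] \<open>open U\<close> zw(3) l by (simp add: closed_def)
  ultimately show False
    using \<open>H x \<subseteq> U\<close> by blast
qed

text \<open>Closedness is outer semicontinuity tested along the constant sequence \<open>x\<close>;
  boundedness holds because \<open>x\<close> lies in its own neighborhood.\<close>

lemma compact_of_outer_semicontinuous_at:
  fixes H :: "'a::topological_space \<Rightarrow> 'b::heine_borel set"
  assumes "outer_semicontinuous_at H x" and "locally_bounded_at H x"
  shows "compact (H x)"
proof -
  have "closed (H x)"
    using assms(1) tendsto_const[of x sequentially]
    unfolding closed_sequential_limits outer_semicontinuous_at_def by blast
  moreover obtain V where "x \<in> interior V" "bounded (svm_image H V)"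
    using assms(2) unfolding locally_bounded_at_def by blast
  then have "bounded (H x)"
    using interior_subset by (auto simp: svm_image_def intro: bounded_subset)
  ultimately show ?thesis
    by (simp add: compact_eq_bounded_closed)
qed

theorem proposition2p6:
  fixes H :: "real ^ 'n \<Rightarrow> (real ^ 'n) set" and x :: "real ^ 'n"
  assumes "outer_semicontinuous H"
    and "locally_bounded_at H x"
  shows "outer_limit (\<lambda>y \<alpha>. convex hull (svm_image H (cball y \<alpha>))) x \<subseteq> convex hull (H x)"
proof
  fix v
  assume "v \<in> outer_limit (\<lambda>y \<alpha>. convex hull (svm_image H (cball y \<alpha>))) x"
  then obtain y \<alpha> u where y: "y \<longlonglongrightarrow> x" and \<alpha>: "\<alpha> \<longlonglongrightarrow> 0" and u: "u \<longlonglongrightarrow> v"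
    and u_in: "\<And>k. u k \<in> convex hull (svm_image H (cball (y k) (\<alpha> k)))"
    unfolding outer_limit_def by blast
  have osc: "outer_semicontinuous_at H x"
    using assms(1) unfolding outer_semicontinuous_def by blast
  show "v \<in> convex hull (H x)"
  proof (rule ccontr)
    assume "v \<notin> convex hull (H x)"
    \<comment> \<open>Compactness matters here: the hull of a merely closed set can fail to be
      closed.\<close>
    moreover have "closed (convex hull (H x))"
      using compact_of_outer_semicontinuous_at[OF osc assms(2)]
      by (simp add: compact_convex_hull compact_imp_closed)
    ultimately obtain a b where "a \<bullet> v < b" and sep: "\<forall>w\<in>convex hull (H x). a \<bullet> w > b"
      using separating_hyperplane_closed_point[OF convex_convex_hull] by blast
    have "H x \<subseteq> {w. a \<bullet> w > b}"
      using sep by (auto intro: hull_inc)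
    then obtain d where "d > 0" and d: "\<And>z. z \<in> ball x d \<Longrightarrow> H z \<subseteq> {w. a \<bullet> w > b}"
      using eventually_subset_of_outer_semicontinuous_at[OF osc assms(2) open_halfspace_gt] by blast
    \<comment> \<open>By the triangle inequality, \<open>cball (y k) (\<alpha> k)\<close> lies in
      \<open>ball x d\<close> once this sum is below \<open>d\<close>.\<close>
    have "(\<lambda>k. dist (y k) x + \<alpha> k) \<longlonglongrightarrow> 0"
      using tendsto_add[OF y[THEN tendsto_dist_iff[THEN iffD1]] \<alpha>] by simp
    then have "\<forall>\<^sub>F k in sequentially. dist (y k) x + \<alpha> k < d"
      using \<open>d > 0\<close> by (rule order_tendstoD(2))
    then have "\<forall>\<^sub>F k in sequentially. b \<le> a \<bullet> u k"
    proof eventually_elim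
      case (elim k)
      then have "cball (y k) (\<alpha> k) \<subseteq> ball x d"
        by (simp add: cball_subset_ball_iff)
      then have "svm_image H (cball (y k) (\<alpha> k)) \<subseteq> {w. a \<bullet> w > b}"
        using d unfolding svm_image_def by blast
      then have "convex hull (svm_image H (cball (y k) (\<alpha> k))) \<subseteq> {w. a \<bullet> w > b}"
        by (rule hull_minimal) (rule convex_halfspace_gt)
      then show ?case
        using u_in[of k] by auto
    qed
    \<comment> \<open>Only the weak inequality survives the limit; it suffices because
      \<open>v\<close> is strictly on the other side.\<close>
    then have "b \<le> a \<bullet> v"
      by (intro tendsto_lowerbound[OF tendsto_inner[OF tendsto_const u]]) simp_all
    with \<open>a \<bullet> v < b\<close> show False
      by simp
  qed
qed

end
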